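(* If $G$ is a $\{P_5,\overline{P_5},\text{bull}\}$-free graph, then at least one of the following holds: $|V(G)|\le 2$; $G$ is isomorphic to $C_5$; $G$ has a homogeneous set; $G$ or $\overline{G}$ is a half graph.
   Context: All graphs are finite and simple. $P_n$ is the path on $n$ vertices, $C_n$ the cycle of length $n$, $\overline{G}$ the complement. $G$ is $\mathcal F$-free if it has no induced subgraph isomorphic to a member of $\mathcal F$. The bull is the graph with vertex set $\{x_1,x_2,x_3,y,z\}$ and edge set $\{x_1x_2,x_2x_3,x_1x_3,x_1y,x_2z\}$. A vertex $b\notin X$ is mixed on $X$ if it has both a neighbor and a non-neighbor in $X$. A homogeneous set is a set $X\subseteq V(G)$ with $1<|X|<|V(G)|$ such that no vertex outside $X$ is mixed on $X$. For $k\ge1$, $O_k$ is the bipartite graph with vertex set $\{a_1,\dots,a_k,b_1,\dots,b_k\}$ in which the only edges are $a_ib_j$ for $i+j\ge k+1$; a half graph is a graph isomorphic to $O_k$ for some $k$. *)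

theory Defs
  imports Main
begin

text \<open>A finite simple graph: finite vertex set V, symmetric irreflexive adjacency E
  (only its restriction to V matters).\<close>
definition simple_graph :: "'a set \<Rightarrow> ('a \<Rightarrow> 'a \<Rightarrow> bool) \<Rightarrow> bool" where
  "simple_graph V E \<longleftrightarrow> finite V \<and> (\<forall>x\<in>V. \<forall>y\<in>V. E x y \<longleftrightarrow> E y x) \<and> (\<forall>x\<in>V. \<not> E x x)"

definition compl_graph :: "('a \<Rightarrow> 'a \<Rightarrow> bool) \<Rightarrow> 'a \<Rightarrow> 'a \<Rightarrow> bool" where
  "compl_graph E = (\<lambda>x y. x \<noteq> y \<and> \<not> E x y)"

definition graph_iso :: "'b set \<Rightarrow> ('b \<Rightarrow> 'b \<Rightarrow> bool) \<Rightarrow> 'a set \<Rightarrow> ('a \<Rightarrow> 'a \<Rightarrow> bool) \<Rightarrow> bool" where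
  "graph_iso HV HE V E \<longleftrightarrow> (\<exists>f. bij_betw f HV V \<and> (\<forall>x\<in>HV. \<forall>y\<in>HV. HE x y \<longleftrightarrow> E (f x) (f y)))"

definition has_induced :: "'a set \<Rightarrow> ('a \<Rightarrow> 'a \<Rightarrow> bool) \<Rightarrow> 'b set \<Rightarrow> ('b \<Rightarrow> 'b \<Rightarrow> bool) \<Rightarrow> bool" where
  "has_induced V E HV HE \<longleftrightarrow> (\<exists>S\<subseteq>V. graph_iso HV HE S E)"

definition P5_V :: "nat set" where "P5_V = {0..<5}"
definition P5_E :: "nat \<Rightarrow> nat \<Rightarrow> bool" where "P5_E i j \<longleftrightarrow> i = j + 1 \<or> j = i + 1"

definition C5_V :: "nat set" where "C5_V = {0..<5}"
definition C5_E :: "nat \<Rightarrow> nat \<Rightarrow> bool" where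
  "C5_E i j \<longleftrightarrow> i = (j + 1) mod 5 \<or> j = (i + 1) mod 5"

text \<open>Bull: vertices x1=0, x2=1, x3=2, y=3, z=4; edges x1x2, x2x3, x1x3, x1y, x2z.\<close>
definition bull_V :: "nat set" where "bull_V = {0..<5}"
definition bull_edges :: "(nat \<times> nat) set" where
  "bull_edges = {(0,1),(1,2),(0,2),(0,3),(1,4)}"
definition bull_E :: "nat \<Rightarrow> nat \<Rightarrow> bool" where
  "bull_E i j \<longleftrightarrow> (i,j) \<in> bull_edges \<or> (j,i) \<in> bull_edges"

text \<open>Half graph O_k: a_i = (False,i), b_j = (True,j), 1 \<le> i,j \<le> k; edges a_i b_j iff i+j \<ge> k+1.\<close>
definition half_V :: "nat \<Rightarrow> (bool \<times> nat) set" where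
  "half_V k = UNIV \<times> {1..k}"
definition half_E :: "nat \<Rightarrow> bool \<times> nat \<Rightarrow> bool \<times> nat \<Rightarrow> bool" where
  "half_E k u v \<longleftrightarrow> fst u \<noteq> fst v \<and> snd u + snd v \<ge> k + 1"

definition is_half_graph :: "'a set \<Rightarrow> ('a \<Rightarrow> 'a \<Rightarrow> bool) \<Rightarrow> bool" where
  "is_half_graph V E \<longleftrightarrow> (\<exists>k\<ge>1. graph_iso (half_V k) (half_E k) V E)"

definition mixed_on :: "'a set \<Rightarrow> ('a \<Rightarrow> 'a \<Rightarrow> bool) \<Rightarrow> 'a \<Rightarrow> 'a set \<Rightarrow> bool" where
  "mixed_on V E b X \<longleftrightarrow> b \<notin> X \<and> (\<exists>x\<in>X. E b x) \<and> (\<exists>x\<in>X. \<not> E b x)"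

definition homogeneous_set :: "'a set \<Rightarrow> ('a \<Rightarrow> 'a \<Rightarrow> bool) \<Rightarrow> 'a set \<Rightarrow> bool" where
  "homogeneous_set V E X \<longleftrightarrow> X \<subseteq> V \<and> 1 < card X \<and> card X < card V \<and>
     (\<forall>b\<in>V - X. \<not> mixed_on V E b X)"

end

theory Submission
  imports Defs
begin

text \<open>
  Let \<open>G\<close> be prime, that is, without homogeneous sets. If \<open>G\<close> contains a \<open>C\<^sub>5\<close>, then the vertices
  attached to it like a given cycle vertex form a set on which nothing is mixed; hence these sets
  are singletons and \<open>G\<close> is the \<open>C\<^sub>5\<close>.

  Otherwise \<open>G\<close> or its complement is triangle-free. Every neighbourhood that contains an edge is
  connected, so as soon as \<open>G\<close> has a triangle, every vertex lies in one; the same holds in the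
  complement. If some vertex \<open>v\<close> is complete to a \<open>P\<^sub>4\<close>, the non-neighbours of \<open>v\<close> form a clique,
  so \<open>v\<close> is in no triangle of the complement, which is therefore triangle-free. Dually, a vertex
  anticomplete to a \<open>P\<^sub>4\<close> makes \<open>G\<close> triangle-free. If neither occurs, every vertex is a clone of a
  vertex of any given \<open>P\<^sub>4\<close>, and \<open>G\<close> is that \<open>P\<^sub>4\<close>.

  A triangle-free \<open>G\<close> is bipartite with one side the neighbourhood of a vertex of maximum degree.
  Excluding \<open>P\<^sub>5\<close> makes neighbourhoods on each side nested, and primality makes them distinct, so
  the degrees on each side are \<open>1, \<dots>, k\<close> and the degree map is an isomorphism to the half graph.
\<close>

section \<open>Complements, isomorphisms and connected vertex sets\<close>

lemma compl_iff: "compl_graph E x y \<longleftrightarrow> x \<noteq> y \<and> \<not> E x y"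
  by (simp add: compl_graph_def)

lemma graph_iso_inverse:
  assumes "bij_betw g V HV" "\<And>y z. y \<in> V \<Longrightarrow> z \<in> V \<Longrightarrow> E y z \<longleftrightarrow> HE (g y) (g z)"
  shows "graph_iso HV HE V E"
proof -
  let ?f = "the_inv_into V g"
  have f: "bij_betw ?f HV V" using assms(1) by (rule bij_betw_the_inv_into)
  moreover have "g (?f p) = p" if "p \<in> HV" for p
    using assms(1) that by (simp add: f_the_inv_into_f_bij_betw)
  ultimately show ?thesis
    unfolding graph_iso_def using assms(2) bij_betwE[OF f] by (intro exI[of _ ?f]) simp
qed

lemma graph_iso_cong:
  assumes "\<And>x y. x \<in> V \<Longrightarrow> y \<in> V \<Longrightarrow> E x y \<longleftrightarrow> F x y"
  shows "graph_iso HV HE V E \<longleftrightarrow> graph_iso HV HE V F"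
  unfolding graph_iso_def using assms by (metis bij_betwE)

lemma compl_compl: "\<forall>x. \<not> E x x \<Longrightarrow> compl_graph (compl_graph E) = E"
  by (auto simp: compl_graph_def fun_eq_iff)

text \<open>Connectedness by cuts instead of walks: a property that changes inside \<open>X\<close>
  then changes along an edge at once.\<close>

definition conn :: "('a \<Rightarrow> 'a \<Rightarrow> bool) \<Rightarrow> 'a set \<Rightarrow> bool" where
  "conn E X \<longleftrightarrow> (\<forall>Y\<subseteq>X. Y \<noteq> {} \<longrightarrow> Y \<noteq> X \<longrightarrow> (\<exists>y\<in>Y. \<exists>z\<in>X - Y. E y z))"

lemma connD:
  assumes "conn E X" "Y \<subseteq> X" "y \<in> Y" "z \<in> X" "z \<notin> Y"
  shows "\<exists>y\<in>Y. \<exists>z\<in>X - Y. E y z"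
  using assms unfolding conn_def by blast

lemma conn_singleton: "conn E {x}"
  unfolding conn_def by blast

lemma conn_insert:
  assumes "symp E" "conn E K" "k \<in> K" "E k z"
  shows "conn E (insert z K)"
  unfolding conn_def
proof (intro allI impI)
  fix Y assume Y: "Y \<subseteq> insert z K" "Y \<noteq> {}" "Y \<noteq> insert z K"
  show "\<exists>y\<in>Y. \<exists>w\<in>insert z K - Y. E y w"
  proof (cases "Y \<inter> K = {} \<or> K \<subseteq> Y")
    case True
    then show ?thesis
    proof
      assume "Y \<inter> K = {}"
      then have "z \<in> Y" "k \<notin> Y" using Y assms(3) by auto
      then show ?thesis using assms by (meson DiffI insertI2 sympD)
    next
      assume "K \<subseteq> Y"
      then have "z \<notin> Y" "k \<in> Y" using Y assms(3) by auto
      then show ?thesis using assms by blast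
    qed
  next
    case False
    then show ?thesis
      using connD[OF assms(2), of "Y \<inter> K"] by blast
  qed
qed

lemma component_exists:
  assumes "finite X" "x \<in> X" "symp E"
  shows "\<exists>K\<subseteq>X. x \<in> K \<and> conn E K \<and> (\<forall>k\<in>K. \<forall>z\<in>X - K. \<not> E k z)"
proof -
  define S where "S = {K. K \<subseteq> X \<and> x \<in> K \<and> conn E K}"
  have "finite S" "{x} \<in> S" using assms(1,2) by (simp_all add: S_def conn_singleton)
  from finite_has_maximal2[OF this]
  obtain K where K: "K \<in> S" and max: "\<forall>L\<in>S. K \<subseteq> L \<longrightarrow> K = L" by blast
  have "\<not> E k z" if "k \<in> K" "z \<in> X - K" for k z
  proof
    assume "E k z"
    then have "insert z K \<in> S" using that K conn_insert[OF assms(3)] by (auto simp: S_def)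
    then show False using max that by blast
  qed
  then show ?thesis using K unfolding S_def by blast
qed

text \<open>Used with \<open>P = E h\<close>: a vertex mixed on a connected set is mixed on one of
  its edges and, with \<open>compl_graph E\<close> in place of \<open>E\<close>, a vertex mixed on
  an anticonnected set is mixed on a non-edge.\<close>

lemma conn_mixed_edge:
  assumes "conn E X" "x \<in> X" "y \<in> X" "P x" "\<not> P y"
  shows "\<exists>u\<in>X. \<exists>w\<in>X. E u w \<and> P u \<and> \<not> P w"
  using connD[OF assms(1), of "{u\<in>X. P u}"] assms by blast

section \<open>Prime graphs without induced \<open>P5\<close>, house (the complement of
  \<open>P5\<close>) or bull\<close>

text \<open>In the forbidden patterns distinctness is left out: none of these graphs has twins, so
  adjacencies and non-adjacencies already force the five vertices to be distinct.\<close>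

locale prime_graph =
  fixes V :: "'a set" and E :: "'a \<Rightarrow> 'a \<Rightarrow> bool"
  assumes fin: "finite V"
    and sym: "E x y \<Longrightarrow> E y x"
    and irr: "\<not> E x x"
    and card_ge_3: "3 \<le> card V"
    and prime: "\<lbrakk>X \<subseteq> V; x \<in> X; y \<in> X; x \<noteq> y; X \<noteq> V\<rbrakk>
      \<Longrightarrow> \<exists>h\<in>V - X. \<exists>u\<in>X. \<exists>w\<in>X. E h u \<and> \<not> E h w"
    and no_P5: "\<lbrakk>a \<in> V; b \<in> V; c \<in> V; d \<in> V; e \<in> V; E a b; E b c; E c d; E d e;
      \<not> E a c; \<not> E a d; \<not> E a e; \<not> E b d; \<not> E b e; \<not> E c e\<rbrakk> \<Longrightarrow> False"
    and no_house: "\<lbrakk>a \<in> V; b \<in> V; c \<in> V; d \<in> V; e \<in> V; E a b; E b c; E c d; E d a; E e a; E e b;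
      \<not> E a c; \<not> E b d; \<not> E e c; \<not> E e d\<rbrakk> \<Longrightarrow> False"
    and no_bull: "\<lbrakk>a \<in> V; b \<in> V; c \<in> V; d \<in> V; e \<in> V; E a b; E b c; E a c; E a d; E b e;
      \<not> E c d; \<not> E c e; \<not> E b d; \<not> E a e; \<not> E d e\<rbrakk> \<Longrightarrow> False"
begin

lemma sym_iff: "E x y \<longleftrightarrow> E y x"
  using sym by blast

lemma symp_E: "symp E"
  by (rule sympI) (rule sym)

lemma three_distinct: "\<exists>x\<in>V. \<exists>y\<in>V. \<exists>z\<in>V. x \<noteq> y \<and> x \<noteq> z \<and> y \<noteq> z"
proof -
  obtain B where "B \<subseteq> V" "card B = 3"
    using card_ge_3 obtain_subset_with_card_n by metis
  then show ?thesis by (auto simp: card_3_iff)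
qed

lemma not_pair: "V \<noteq> {x, y}"
  using three_distinct by blast

text \<open>\<open>P5\<close> and house are complementary, the bull is self-complementary, and a
  mixed vertex stays mixed in the complement. This makes the results of the locale available in dual
  form.\<close>

lemma complement: "prime_graph V (compl_graph E)"
proof
  show "\<exists>h\<in>V - X. \<exists>u\<in>X. \<exists>w\<in>X. compl_graph E h u \<and> \<not> compl_graph E h w"
    if X: "X \<subseteq> V" "x \<in> X" "y \<in> X" "x \<noteq> y" "X \<noteq> V" for X x y
  proof -
    obtain h u w where "h \<in> V - X" "u \<in> X" "w \<in> X" "E h u" "\<not> E h w"
      using prime[OF X] by blast
    moreover have "h \<noteq> w" using calculation by blast
    ultimately show ?thesis unfolding compl_iff by blast
  qed
next
  have cosym: "compl_graph E x y \<Longrightarrow> compl_graph E y x" for x y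
    using sym unfolding compl_iff by blast
  fix a b c d e
  assume V: "a \<in> V" "b \<in> V" "c \<in> V" "d \<in> V" "e \<in> V"
  { assume co: "compl_graph E a b" "compl_graph E b c" "compl_graph E c d" "compl_graph E d e"
      "\<not> compl_graph E a c" "\<not> compl_graph E a d" "\<not> compl_graph E a e"
      "\<not> compl_graph E b d" "\<not> compl_graph E b e" "\<not> compl_graph E c e"
    \<comment> \<open>Non-adjacency in the complement also allows equality, so distinctness comes
      before the translation to \<open>E\<close>.\<close>
    have "a \<noteq> c" "a \<noteq> d" "a \<noteq> e" "b \<noteq> d" "b \<noteq> e" "c \<noteq> e"
      using co cosym by metis+
    then show False
      using co no_house[OF V(1,5,2,4,3)] sym unfolding compl_iff by blast }
  { assume co: "compl_graph E a b" "compl_graph E b c" "compl_graph E c d" "compl_graph E d a"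
      "compl_graph E e a" "compl_graph E e b" "\<not> compl_graph E a c" "\<not> compl_graph E b d"
      "\<not> compl_graph E e c" "\<not> compl_graph E e d"
    have "a \<noteq> c" "b \<noteq> d" "e \<noteq> c" "e \<noteq> d"
      using co cosym by metis+
    then show False
      using co no_P5[OF V(1,3,5,4,2)] sym unfolding compl_iff by blast }
  { assume co: "compl_graph E a b" "compl_graph E b c" "compl_graph E a c" "compl_graph E a d"
      "compl_graph E b e" "\<not> compl_graph E c d" "\<not> compl_graph E c e" "\<not> compl_graph E b d"
      "\<not> compl_graph E a e" "\<not> compl_graph E d e"
    have "c \<noteq> d" "c \<noteq> e" "b \<noteq> d" "a \<noteq> e" "d \<noteq> e"
      using co cosym by metis+
    then show False
      using co no_bull[OF V(4,5,3,2,1)] sym unfolding compl_iff by blast }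
qed (auto simp: compl_iff fin irr card_ge_3 dest: sym)

text \<open>If no edge left \<open>Y\<close>, nothing would be mixed on \<open>Y\<close> or on
  \<open>V - Y\<close>; both would be singletons, too few for three vertices.\<close>

lemma edge_across:
  assumes "Y \<subseteq> V" "Y \<noteq> {}" "Y \<noteq> V"
  shows "\<exists>y\<in>Y. \<exists>z\<in>V - Y. E y z"
proof (rule ccontr)
  assume no: "\<not> ?thesis"
  have sing: "x = y" if "x \<in> Z" "y \<in> Z" "Z = Y \<or> Z = V - Y" for x y Z
  proof (rule ccontr)
    assume "x \<noteq> y"
    have "Z \<subseteq> V" "Z \<noteq> V" using that assms by auto
    then show False using prime[OF _ that(1,2) \<open>x \<noteq> y\<close>] no that(3) sym by blast
  qed
  obtain y where y: "y \<in> Y" using assms(2) by blast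
  obtain z where z: "z \<in> V - Y" using assms(1,3) by blast
  have "Y = {y}" using sing[OF _ y] y by fast
  moreover have "V - Y = {z}" using sing[OF _ z] z by fast
  ultimately have "V = {y, z}" using assms(1) by blast
  then show False using not_pair by blast
qed

text \<open>A vertex mixed on one component of a disconnected neighbourhood \<open>N(x)\<close> gives, together
  with \<open>x\<close> and a vertex of another component, a bull or a house.\<close>

lemma nbhd_with_edge_conn:
  assumes "x \<in> V" "b \<in> V" "c \<in> V" "E x b" "E x c" "E b c"
  shows "conn E {y\<in>V. E x y}"
proof -
  let ?N = "{y\<in>V. E x y}"
  obtain K where K: "K \<subseteq> ?N" "b \<in> K" "conn E K" "\<forall>k\<in>K. \<forall>z\<in>?N - K. \<not> E k z"
    using component_exists[of ?N b E] fin assms symp_E by auto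
  have "c \<in> K" using K assms by blast
  have "K = ?N"
  proof (rule ccontr)
    assume "K \<noteq> ?N"
    then obtain d where d: "d \<in> ?N" "d \<notin> K" using K by blast
    have "b \<noteq> c" using assms irr by blast
    then obtain e u w where e: "e \<in> V - K" "u \<in> K" "w \<in> K" "E e u" "\<not> E e w"
      using prime[of K b c] K(1,2) \<open>c \<in> K\<close> d by blast
    have "e \<notin> ?N" using K(4) e sym by blast
    obtain u w where uw: "u \<in> K" "w \<in> K" "E u w" "E e u" "\<not> E e w"
      using conn_mixed_edge[OF K(3), of u w "E e"] e by blast
    have V: "x \<in> V" "u \<in> V" "w \<in> V" "e \<in> V" "d \<in> V" using assms K uw e d by auto
    have "E x u" "E x w" "E x d" "\<not> E u d" "\<not> E w d" "\<not> E x e"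
      using K uw d V \<open>e \<notin> ?N\<close> by auto
    then show False
      using no_house[OF V(1,2,4,5,3)] no_bull[OF V(1,2,3,5,4)] uw sym by blast
  qed
  then show ?thesis using K(3) by simp
qed

text \<open>Otherwise an edge \<open>x y\<close> leaves the set of vertices in triangles. The
  neighbourhood of \<open>x\<close> contains an edge, so it is connected, and \<open>y\<close> has a
  neighbour in it.\<close>

lemma triangle_everywhere:
  assumes "a \<in> V" "b \<in> V" "c \<in> V" "E a b" "E b c" "E a c" "x \<in> V"
  shows "\<exists>y\<in>V. \<exists>z\<in>V. E x y \<and> E x z \<and> E y z"
proof (rule ccontr)
  let ?S = "{x\<in>V. \<exists>y\<in>V. \<exists>z\<in>V. E x y \<and> E x z \<and> E y z}"
  assume "\<not> ?thesis"
  then have "?S \<noteq> V" using assms(7) by blast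
  moreover have "a \<in> ?S" using assms by blast
  ultimately obtain x y where xy: "x \<in> ?S" "y \<in> V" "y \<notin> ?S" "E x y"
    using edge_across[of ?S] by blast
  obtain b c where bc: "b \<in> V" "c \<in> V" "E x b" "E x c" "E b c" using xy by blast
  have "b \<noteq> c" using bc irr by blast
  then obtain w where w: "w \<in> V" "E x w" "w \<noteq> y" using bc by blast
  have "conn E {y\<in>V. E x y}" using nbhd_with_edge_conn[OF _ bc] xy by blast
  from connD[OF this, of "{y}" y w] obtain z where "z \<in> V" "E x z" "E y z"
    using xy w by blast
  then show False using xy sym by blast
qed

section \<open>Existence of an induced path on four vertices\<close>

definition P4 :: "'a \<Rightarrow> 'a \<Rightarrow> 'a \<Rightarrow> 'a \<Rightarrow> bool" where
  "P4 a b c d \<longleftrightarrow> a \<in> V \<and> b \<in> V \<and> c \<in> V \<and> d \<in> V \<and> E a b \<and> E b c \<and> E c d \<and>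
     \<not> E a c \<and> \<not> E a d \<and> \<not> E b d"

lemma P4_rev: "P4 a b c d \<Longrightarrow> P4 d c b a"
  unfolding P4_def using sym by blast

lemma P4_distinct:
  assumes "P4 a b c d"
  shows "a \<noteq> b" "a \<noteq> c" "a \<noteq> d" "b \<noteq> c" "b \<noteq> d" "c \<noteq> d"
  using assms irr sym unfolding P4_def by metis+

lemma P4_compl:
  assumes "P4 a b c d"
  shows "prime_graph.P4 V (compl_graph E) b d a c"
proof -
  interpret co: prime_graph V "compl_graph E" by (rule complement)
  show ?thesis using assms P4_distinct[OF assms]
    unfolding P4_def co.P4_def compl_iff by (auto dest: sym)
qed

text \<open>Without such a path the non-neighbours of a vertex are stable; in the complement this
  turns neighbourhoods into cliques. Then a closed neighbourhood with at least two vertices is all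
  of \<open>V\<close>, and no vertex can be mixed on a pair.\<close>

lemma P4_exists: "\<exists>a b c d. P4 a b c d"
proof (rule ccontr)
  assume no: "\<not> ?thesis"
  \<comment> \<open>Stated for any \<open>F\<close> because it is applied to the complement. A
    vertex \<open>h\<close> mixed on a component of the non-neighbours of \<open>x\<close> must see
    \<open>x\<close>, whence the path \<open>x h u w\<close>.\<close>
  have stable: "\<not> F c d"
    if pg: "prime_graph V F" and nP4: "\<nexists>a b c d. prime_graph.P4 V F a b c d"
      and V: "x \<in> V" "c \<in> V" "d \<in> V" "\<not> F x c" "\<not> F x d" "x \<noteq> c" "x \<noteq> d" for F x c d
  proof
    interpret F: prime_graph V F by fact
    assume "F c d"
    let ?R = "{y\<in>V. \<not> F x y \<and> y \<noteq> x}"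
    obtain K where K: "K \<subseteq> ?R" "c \<in> K" "conn F K" "\<forall>k\<in>K. \<forall>z\<in>?R - K. \<not> F k z"
      using component_exists[of ?R c F] fin V F.symp_E by auto
    have "d \<in> K" using K V \<open>F c d\<close> by blast
    have "c \<noteq> d" using \<open>F c d\<close> F.irr by blast
    moreover have "x \<notin> K" using K by blast
    ultimately obtain h u w where h: "h \<in> V - K" "u \<in> K" "w \<in> K" "F h u" "\<not> F h w"
      using F.prime[of K c d] K(1,2) \<open>d \<in> K\<close> V(1) by blast
    obtain u w where uw: "u \<in> K" "w \<in> K" "F u w" "F h u" "\<not> F h w"
      using conn_mixed_edge[OF K(3), of u w "F h"] h by blast
    have "h \<noteq> x" using K uw by blast
    then have "F x h" using K h uw F.sym by blast
    then have "F.P4 x h u w" using V h uw K unfolding F.P4_def by blast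
    then show False using nP4 by blast
  qed
  interpret co: prime_graph V "compl_graph E" by (rule complement)
  have "compl_graph (compl_graph E) = E"
    using irr by (simp add: compl_compl)
  then have "\<nexists>a b c d. co.P4 a b c d" using no co.P4_compl by metis
  then have clique: "E c d" if "x \<in> V" "c \<in> V" "d \<in> V" "E x c" "E x d" "c \<noteq> d" for x c d
    using stable[OF complement, of x c d] that irr unfolding compl_iff by blast
  have complete: "E x z" if xy: "x \<in> V" "y \<in> V" "E x y" and "z \<in> V" "z \<noteq> x" for x y z
  proof -
    let ?C = "{z\<in>V. z = x \<or> E x z}"
    have "x \<noteq> y" using xy irr by blast
    have "?C = V"
    proof (rule ccontr)
      assume "?C \<noteq> V"
      then obtain h u w where "h \<in> V - ?C" "u \<in> ?C" "w \<in> ?C" "E h u" "\<not> E h w"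
        using prime[of ?C x y] xy \<open>x \<noteq> y\<close> by blast
      then show False using clique[of u x h] sym xy(1) by blast
    qed
    then show ?thesis using that by blast
  qed
  obtain x y where xy: "x \<in> V" "y \<in> V" "x \<noteq> y" using three_distinct by blast
  obtain h u w where h: "h \<in> V - {x, y}" "E h u" "\<not> E h w" "u \<in> {x, y}" "w \<in> {x, y}"
    using prime[of "{x, y}" x y] xy not_pair[of x y] by blast
  then have "E h w" using complete[of h u w] xy by blast
  then show False using h by blast
qed

section \<open>Five-cycles\<close>

definition C5 :: "'a \<Rightarrow> 'a \<Rightarrow> 'a \<Rightarrow> 'a \<Rightarrow> 'a \<Rightarrow> bool" where
  "C5 a b c d e \<longleftrightarrow> a \<in> V \<and> b \<in> V \<and> c \<in> V \<and> d \<in> V \<and> e \<in> V \<and>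
     E a b \<and> E b c \<and> E c d \<and> E d e \<and> E e a \<and>
     \<not> E a c \<and> \<not> E a d \<and> \<not> E b d \<and> \<not> E b e \<and> \<not> E c e"

lemma C5_rotate: "C5 a b c d e \<Longrightarrow> C5 b c d e a"
  unfolding C5_def by (auto simp: sym_iff)

text \<open>The four traces give \<open>P5\<close>, bull, house and house. Up to rotation only the
  full trace, the empty trace and those of clones of a cycle vertex survive.\<close>

lemma C5_ext_aux:
  assumes "C5 a b c d e" "w \<in> V"
  shows "\<not> (E w a \<and> \<not> E w b \<and> \<not> E w c \<and> \<not> E w d \<and> \<not> E w e)"
    and "\<not> (E w a \<and> E w b \<and> \<not> E w c \<and> \<not> E w d \<and> \<not> E w e)"
    and "\<not> (E w a \<and> E w b \<and> \<not> E w c \<and> E w d \<and> \<not> E w e)"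
    and "\<not> (E w a \<and> E w b \<and> E w c \<and> E w d \<and> \<not> E w e)"
  using assms no_P5[of w a b c d] no_bull[of a b w e c] no_house[of w b c d a]
    no_house[of w a e d b]
  unfolding C5_def by (auto simp: sym_iff)

lemma C5_ext:
  assumes "C5 a b c d e" "w \<in> V"
  shows "E w a \<and> E w b \<and> E w c \<and> E w d \<and> E w e \<or>
    \<not> E w a \<and> \<not> E w b \<and> \<not> E w c \<and> \<not> E w d \<and> \<not> E w e \<or>
    E w b \<and> E w e \<and> \<not> E w c \<and> \<not> E w d \<or>
    E w c \<and> E w a \<and> \<not> E w d \<and> \<not> E w e \<or>
    E w d \<and> E w b \<and> \<not> E w e \<and> \<not> E w a \<or>
    E w e \<and> E w c \<and> \<not> E w a \<and> \<not> E w b \<or>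
    E w a \<and> E w d \<and> \<not> E w b \<and> \<not> E w c"
proof -
  note r0 = assms(1)
  note r1 = C5_rotate[OF r0]
  note r2 = C5_rotate[OF r1]
  note r3 = C5_rotate[OF r2]
  note r4 = C5_rotate[OF r3]
  note aux = C5_ext_aux[OF _ assms(2)]
  show ?thesis
    using aux[OF r0] aux[OF r1] aux[OF r2] aux[OF r3] aux[OF r4] by argo
qed

text \<open>Nothing is mixed on the set \<open>?A\<close> of clones of \<open>a\<close>: the traces
  of \<open>h\<close> on the cycles through \<open>u\<close> and through \<open>w\<close> differ
  only in that vertex, and \<open>C5_ext\<close> allows this only if \<open>h\<close> is a clone of
  \<open>a\<close> itself.\<close>

lemma C5_clone_unique:
  assumes C: "C5 a b c d e" and x: "x \<in> V" "E x b" "E x e" "\<not> E x c" "\<not> E x d"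
  shows "x = a"
proof (rule ccontr)
  assume "x \<noteq> a"
  let ?A = "{x\<in>V. E x b \<and> E x e \<and> \<not> E x c \<and> \<not> E x d}"
  have "a \<in> ?A" using C unfolding C5_def by (auto simp: sym_iff)
  moreover have "b \<notin> ?A" "b \<in> V" using C irr unfolding C5_def by auto
  ultimately obtain h u w where h: "h \<in> V - ?A" "u \<in> ?A" "w \<in> ?A" "E h u" "\<not> E h w"
    using prime[of ?A x a] x \<open>x \<noteq> a\<close> by blast
  have "C5 u b c d e" "C5 w b c d e" using C h(2,3) unfolding C5_def by (auto simp: sym_iff)
  from C5_ext[OF this(1), of h] C5_ext[OF this(2), of h] h show False by auto
qed

lemma C5_spans:
  assumes "C5 a b c d e"
  shows "V = {a, b, c, d, e}"
proof (rule ccontr)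
  assume "V \<noteq> {a, b, c, d, e}"
  note r0 = assms(1)
  note r1 = C5_rotate[OF r0]
  note r2 = C5_rotate[OF r1]
  note r3 = C5_rotate[OF r2]
  note r4 = C5_rotate[OF r3]
  have "a \<noteq> b" "{a, b, c, d, e} \<subseteq> V" using assms irr unfolding C5_def by auto
  then obtain h u w where h: "h \<in> V" "h \<notin> {a, b, c, d, e}" "u \<in> {a, b, c, d, e}"
      "w \<in> {a, b, c, d, e}" "E h u" "\<not> E h w"
    using prime[of "{a, b, c, d, e}" a b] \<open>V \<noteq> _\<close> by blast
  note cl = C5_clone_unique[OF _ h(1)]
  from C5_ext[OF r0 h(1)] cl[OF r0] cl[OF r1] cl[OF r2] cl[OF r3] cl[OF r4] h
  show False by auto
qed

section \<open>Non-neighbours mixed on part of a neighbourhood\<close>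

text \<open>If \<open>c\<close> missed both ends of \<open>a b\<close>, the five vertices would form
  a house when \<open>c\<close> sees \<open>r\<close>, and a bull otherwise.\<close>

lemma crossing_edge_dominates:
  assumes "v \<in> V" "a \<in> V" "b \<in> V" "c \<in> V" "r \<in> V" "E v a" "E v b" "E v c" "E a b"
    and "\<not> E v r" "E r a" "\<not> E r b"
  shows "E c a \<or> E c b"
  using assms no_house[of v a r c b] no_bull[of v a b c r] by (auto simp: sym_iff)

text \<open>A maximal counterexample \<open>M\<close> is mixed by some \<open>h \<in> N(v)\<close>. By maximality a non-neighbour \<open>r\<close>
  of \<open>v\<close> separates \<open>h\<close> from \<open>M\<close>, so the edges from \<open>h\<close> to \<open>M\<close> dominate \<open>N(v)\<close>, against
  anticonnectedness of \<open>M\<close>.\<close>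

lemma nonneighbour_mixed:
  assumes v: "v \<in> V" and Q: "Q \<subseteq> {y\<in>V. E v y}" "conn E Q" "conn (compl_graph E) Q"
    and xy: "x \<in> Q" "y \<in> Q" "x \<noteq> y"
  shows "\<exists>r\<in>V. r \<noteq> v \<and> \<not> E v r \<and> (\<exists>x\<in>Q. \<exists>y\<in>Q. E r x \<and> \<not> E r y)"
proof (rule ccontr)
  interpret co: prime_graph V "compl_graph E" by (rule complement)
  define mix where "mix Q r \<longleftrightarrow> (\<exists>x\<in>Q. \<exists>y\<in>Q. E r x \<and> \<not> E r y)" for Q r
  \<comment> \<open>Every member keeps \<open>x\<close> and \<open>y\<close>, so the maximal one has
    two elements and primality applies to it.\<close>
  define S where "S = {Q. Q \<subseteq> {y\<in>V. E v y} \<and> conn E Q \<and> conn (compl_graph E) Q \<and>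
    x \<in> Q \<and> y \<in> Q \<and> (\<forall>r\<in>V. r \<noteq> v \<longrightarrow> \<not> E v r \<longrightarrow> \<not> mix Q r)}"
  assume "\<not> ?thesis"
  then have "Q \<in> S" using Q xy unfolding S_def mix_def by blast
  moreover have "finite S"
    by (rule finite_subset[of _ "Pow V"]) (use fin in \<open>auto simp: S_def\<close>)
  ultimately obtain M where M: "M \<in> S" and max: "\<forall>L\<in>S. M \<subseteq> L \<longrightarrow> M = L"
    using finite_has_maximal2[of S Q] by blast
  have MS: "M \<subseteq> {y\<in>V. E v y}" "conn E M" "conn (compl_graph E) M" "x \<in> M" "y \<in> M"
    and unmixed: "\<And>r. r \<in> V \<Longrightarrow> r \<noteq> v \<Longrightarrow> \<not> E v r \<Longrightarrow> \<not> mix M r"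
    using M unfolding S_def by auto
  have "v \<notin> M" using MS irr by blast
  then obtain h u w where h: "h \<in> V" "h \<notin> M" "u \<in> M" "w \<in> M" "E h u" "\<not> E h w"
    using prime[of M x y] MS(1,4,5) xy(3) v by blast
  have "mix M h" using h unfolding mix_def by blast
  moreover have "h \<noteq> v" using MS(1) h by blast
  ultimately have "E v h" using unmixed h by blast
  have "conn E (insert h M)" using conn_insert[OF symp_E MS(2) h(3)] sym[OF h(5)] by blast
  moreover have "conn (compl_graph E) (insert h M)"
    using conn_insert[OF co.symp_E MS(3) h(4), of h] h sym by (auto simp: compl_iff)
  moreover have "insert h M \<notin> S" using max h by blast
  ultimately obtain r where r: "r \<in> V" "r \<noteq> v" "\<not> E v r" "mix (insert h M) r"
    using MS \<open>E v h\<close> h(1) unfolding S_def by auto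
  obtain q q' where q: "q \<in> M" "q' \<in> M" "compl_graph E q q'" "E h q" "\<not> E h q'"
    using conn_mixed_edge[OF MS(3) h(3,4), of "E h"] h by blast
  have nm: "\<not> mix M r" using unmixed r by blast
  have cross: "E r h \<and> \<not> E r q \<or> \<not> E r h \<and> E r q"
    using r(4) nm q(1) unfolding mix_def by blast
  have "q \<in> V" "q' \<in> V" "E v q" "E v q'" "\<not> E q q'" using q MS(1) by (auto simp: compl_iff)
  then have "E q' h \<or> E q' q"
    using cross crossing_edge_dominates[of v h q q' r] crossing_edge_dominates[of v q h q' r]
      v h(1) r \<open>E v h\<close> q(4) sym by blast
  then show False using q \<open>\<not> E q q'\<close> sym by blast
qed

end

section \<open>Centres and anticentres of a \<open>P4\<close> in graphs without
  \<open>C5\<close>\<close>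

locale prime_C5_free = prime_graph +
  assumes no_C5: "\<not> C5 a b c d e"
begin

lemma complement_C5_free: "prime_C5_free V (compl_graph E)"
proof -
  interpret co: prime_graph V "compl_graph E" by (rule complement)
  show ?thesis
  proof
    fix a b c d e
    show "\<not> co.C5 a b c d e"
    proof
      assume co: "co.C5 a b c d e"
      then have "a \<noteq> c" "a \<noteq> d" "b \<noteq> d" "b \<noteq> e" "c \<noteq> e"
        using co.sym unfolding co.C5_def by metis+
      then have "C5 a c e b d" using co unfolding co.C5_def C5_def by (auto simp: compl_iff dest: sym)
      then show False using no_C5 by blast
    qed
  qed
qed

text \<open>The traces give \<open>P5\<close>, bull, \<open>C5\<close> and house; with their
  reversals excluded too, the full trace, the empty trace and those of clones of the path vertices
  remain.\<close>

lemma P4_ext_aux: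
  assumes "P4 a b c d" "w \<in> V"
  shows "\<not> (E w a \<and> \<not> E w b \<and> \<not> E w c \<and> \<not> E w d)"
    and "\<not> (\<not> E w a \<and> E w b \<and> E w c \<and> \<not> E w d)"
    and "\<not> (E w a \<and> \<not> E w b \<and> \<not> E w c \<and> E w d)"
    and "\<not> (E w a \<and> E w b \<and> \<not> E w c \<and> E w d)"
  using assms no_P5[of w a b c d] no_bull[of b c w a d] no_C5[of w a b c d]
    no_house[of w b c d a]
  unfolding P4_def C5_def by (auto simp: sym_iff)

lemma P4_ext:
  assumes "P4 a b c d" "w \<in> V"
  shows "E w a \<and> E w b \<and> E w c \<and> E w d \<or>
    \<not> E w a \<and> \<not> E w b \<and> \<not> E w c \<and> \<not> E w d \<or>
    E w b \<and> \<not> E w c \<and> \<not> E w d \<or>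
    E w a \<and> E w c \<and> \<not> E w d \<or>
    \<not> E w a \<and> E w b \<and> E w d \<or>
    \<not> E w a \<and> \<not> E w b \<and> E w c"
  using P4_ext_aux[OF assms] P4_ext_aux[OF P4_rev[OF assms(1)] assms(2)] by argo

definition gem :: "'a \<Rightarrow> 'a \<Rightarrow> 'a \<Rightarrow> 'a \<Rightarrow> 'a \<Rightarrow> bool" where
  "gem v a b c d \<longleftrightarrow> P4 a b c d \<and> v \<in> V \<and> E v a \<and> E v b \<and> E v c \<and> E v d"

lemma gem_rev: "gem v a b c d \<Longrightarrow> gem v d c b a"
  unfolding gem_def using P4_rev by blast

lemma gem_nonneighbour_aux:
  assumes "gem v a b c d" "r \<in> V" "\<not> E v r"
  shows "\<not> (E r a \<and> \<not> E r b \<and> E r c \<and> \<not> E r d)"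
    and "\<not> (\<not> E r a \<and> E r b \<and> \<not> E r c \<and> \<not> E r d)"
    and "\<not> (E r a \<and> E r b \<and> E r c \<and> \<not> E r d)"
  using assms no_bull[of v a b d r] no_bull[of v b a d r] no_house[of v c r a d]
  unfolding gem_def P4_def by (auto simp: sym_iff)

text \<open>Of the clone traces in \<open>P4_ext\<close>, all but the two end edges of the path
  produce a bull or a house with the centre \<open>v\<close>.\<close>

lemma gem_nonneighbour:
  assumes "gem v a b c d" "r \<in> V" "\<not> E v r"
  shows "E r a \<and> E r b \<and> E r c \<and> E r d \<or>
    \<not> E r a \<and> \<not> E r b \<and> \<not> E r c \<and> \<not> E r d \<or>
    E r a \<and> E r b \<and> \<not> E r c \<and> \<not> E r d \<or>
    \<not> E r a \<and> \<not> E r b \<and> E r c \<and> E r d"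
proof -
  have "P4 a b c d" using assms(1) unfolding gem_def by blast
  from P4_ext[OF this assms(2)] gem_nonneighbour_aux[OF assms]
    gem_nonneighbour_aux[OF gem_rev[OF assms(1)] assms(2,3)]
  show ?thesis by argo
qed

lemma P4_conn:
  assumes "P4 a b c d"
  shows "conn E {a, b, c, d}"
proof -
  have "conn E {c, d}"
    using conn_insert[OF symp_E conn_singleton[of E d], of d c] assms sym
    unfolding P4_def by blast
  then have "conn E {b, c, d}"
    using conn_insert[OF symp_E, of "{c, d}" c b] assms sym unfolding P4_def by blast
  then show ?thesis
    using conn_insert[OF symp_E, of "{b, c, d}" b a] assms sym unfolding P4_def by blast
qed

text \<open>The path is connected and anticonnected, so \<open>nonneighbour_mixed\<close> applies to
  it.\<close>

lemma gem_mixed_nonneighbour: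
  assumes "gem v a b c d"
  shows "\<exists>r\<in>V. r \<noteq> v \<and> \<not> E v r \<and>
    (E r a \<and> E r b \<and> \<not> E r c \<and> \<not> E r d \<or> \<not> E r a \<and> \<not> E r b \<and> E r c \<and> E r d)"
proof -
  interpret co: prime_C5_free V "compl_graph E" by (rule complement_C5_free)
  have P: "P4 a b c d" using assms unfolding gem_def by blast
  have "{b, d, a, c} = {a, b, c, d}" by blast
  then have "conn (compl_graph E) {a, b, c, d}" using co.P4_conn[OF P4_compl[OF P]] by simp
  moreover have "{a, b, c, d} \<subseteq> {y\<in>V. E v y}" "v \<in> V" using assms unfolding gem_def P4_def by auto
  ultimately obtain r x y where r: "r \<in> V" "r \<noteq> v" "\<not> E v r" "x \<in> {a, b, c, d}"
      "y \<in> {a, b, c, d}" "E r x" "\<not> E r y"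
    using nonneighbour_mixed[OF _ _ P4_conn[OF P], of v a b] P4_distinct[OF P] by blast
  then show ?thesis using gem_nonneighbour[OF assms r(1,3)] by blast
qed

text \<open>A non-neighbour \<open>r\<close> of \<open>v\<close> attached to one end edge crosses
  the middle edge \<open>b c\<close>, which therefore dominates the neighbourhood of
  \<open>v\<close>.\<close>

lemma gem_no_adjacent_anticentre:
  assumes "gem v a b c d" "u \<in> V" "E u v"
  shows "E u a \<or> E u b \<or> E u c \<or> E u d"
proof -
  obtain r where r: "r \<in> V" "r \<noteq> v" "\<not> E v r"
    "E r a \<and> E r b \<and> \<not> E r c \<and> \<not> E r d \<or> \<not> E r a \<and> \<not> E r b \<and> E r c \<and> E r d"
    using gem_mixed_nonneighbour[OF assms(1)] by blast
  have "E u b \<or> E u c"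
    using r crossing_edge_dominates[of v b c u r] crossing_edge_dominates[of v c b u r] assms sym
    unfolding gem_def P4_def by blast
  then show ?thesis by blast
qed

text \<open>The \<open>P\<^sub>4\<close> is self-complementary, and passing to the complement exchanges centre and
  anticentre, so the adjacent case suffices.\<close>

lemma gem_no_anticentre:
  assumes "gem v a b c d" "u \<in> V"
  shows "E u a \<or> E u b \<or> E u c \<or> E u d"
proof (rule ccontr)
  assume no: "\<not> ?thesis"
  interpret co: prime_C5_free V "compl_graph E" by (rule complement_C5_free)
  have P: "P4 a b c d" using assms unfolding gem_def by blast
  have "\<not> E u v" using gem_no_adjacent_anticentre[OF assms] no by blast
  moreover have ne: "u \<noteq> v" "u \<noteq> a" "u \<noteq> b" "u \<noteq> c" "u \<noteq> d"
    using assms no sym unfolding gem_def P4_def by metis+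
  moreover have "co.gem u b d a c"
    using P4_compl[OF P] ne no assms(2) unfolding co.gem_def by (simp add: compl_iff)
  moreover have "v \<in> V" "E v a" "E v b" "E v c" "E v d" using assms unfolding gem_def by auto
  ultimately show False
    using co.gem_no_adjacent_anticentre[of u b d a c v] sym by (auto simp: compl_iff)
qed

text \<open>Otherwise a vertex \<open>h\<close> splits a non-edge \<open>s t\<close> in an
  anticomponent of the set of centres. Such an \<open>h\<close> is no centre, so it sees exactly an
  end edge of the path, and \<open>h\<close>, \<open>s\<close>, \<open>t\<close>, \<open>a\<close>,
  \<open>d\<close> form a house.\<close>

lemma gem_centres_adjacent:
  assumes g: "gem v a b c d" "gem v' a b c d" and ne: "v \<noteq> v'"
  shows "E v v'"
proof (rule ccontr)
  assume "\<not> E v v'"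
  interpret co: prime_graph V "compl_graph E" by (rule complement)
  let ?C = "{v. gem v a b c d}"
  have C: "?C \<subseteq> V" unfolding gem_def by blast
  have P: "P4 a b c d" using g unfolding gem_def by blast
  obtain K where K: "K \<subseteq> ?C" "v \<in> K" "conn (compl_graph E) K"
      "\<forall>k\<in>K. \<forall>z\<in>?C - K. \<not> compl_graph E k z"
    using component_exists[of ?C v "compl_graph E"] finite_subset[OF C fin] g co.symp_E by auto
  have "v' \<in> K" using K g ne \<open>\<not> E v v'\<close> unfolding compl_iff by blast
  moreover have "a \<notin> K" "a \<in> V" using K P irr unfolding gem_def P4_def by auto
  moreover have "K \<subseteq> V" using K C by blast
  ultimately obtain h u w where h: "h \<in> V - K" "u \<in> K" "w \<in> K" "E h u" "\<not> E h w"
    using prime[of K v v'] K(2) ne by blast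
  obtain s t where st: "s \<in> K" "t \<in> K" "compl_graph E s t" "E h s" "\<not> E h t"
    using conn_mixed_edge[OF K(3) h(2,3), of "E h"] h by blast
  have gst: "gem s a b c d" "gem t a b c d" using st K by auto
  have "h \<notin> ?C"
  proof
    assume "h \<in> ?C"
    then have "\<not> compl_graph E t h" using K(4) st(2) h(1) by blast
    moreover have "h \<noteq> t" using h(1) st(2) by blast
    ultimately show False using st(5) sym unfolding compl_iff by blast
  qed
  then have "\<not> (E h a \<and> E h b \<and> E h c \<and> E h d)" using P h(1) unfolding gem_def by blast
  moreover have "\<not> E t h" using st sym by blast
  ultimately have "E h a \<and> E h b \<and> \<not> E h c \<and> \<not> E h d \<or> \<not> E h a \<and> \<not> E h b \<and> E h c \<and> E h d"
    using gem_nonneighbour[OF gst(2), of h] gem_no_anticentre[OF gst(2), of h] h(1) by blast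
  then show False
    using no_house[of s a t d h] no_house[of s d t a h] gst st h(1)
    unfolding gem_def P4_def by (auto simp: sym_iff compl_iff)
qed

lemma gem_nonneighbour_type:
  assumes "gem v a b c d" "r \<in> V" "\<not> E v r" "r \<noteq> v"
  shows "E r a \<and> E r b \<and> \<not> E r c \<and> \<not> E r d \<or> \<not> E r a \<and> \<not> E r b \<and> E r c \<and> E r d"
proof -
  have "\<not> gem r a b c d" using gem_centres_adjacent[OF assms(1)] assms by blast
  then show ?thesis
    using gem_nonneighbour[OF assms(1-3)] gem_no_anticentre[OF assms(1,2)] assms(1,2)
    unfolding gem_def by blast
qed

text \<open>Otherwise \<open>a\<close> and \<open>x\<close> lie in one anticomponent
  \<open>K\<close> of \<open>?F\<close>. Its members are interchangeable as ends of the path, and a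
  vertex \<open>h\<close> splitting a non-edge \<open>s t\<close> of \<open>K\<close> contradicts
  what is known about centres and anticentres.\<close>

lemma gem_no_false_clone:
  assumes g: "gem v a b c d" and x: "x \<in> V" "x \<noteq> a" "E x b" "\<not> E x a" "\<not> E x c" "\<not> E x d"
  shows False
proof -
  interpret co: prime_graph V "compl_graph E" by (rule complement)
  have adj: "E v x" if "gem v a b c d" "x \<in> V" "E x b" "\<not> E x a" "\<not> E x c" "\<not> E x d" for v a x
  proof (rule ccontr)
    assume "\<not> E v x"
    moreover have "x \<noteq> v" using that unfolding gem_def by blast
    ultimately show False using gem_nonneighbour_type[of v a b c d x] that by blast
  qed
  let ?F = "{x\<in>V. E x b \<and> \<not> E x c \<and> \<not> E x d \<and> E x v}"
  have V: "v \<in> V" "a \<in> V" "b \<in> V" "c \<in> V" "d \<in> V" using g unfolding gem_def P4_def by auto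
  have a: "a \<in> ?F" using g sym unfolding gem_def P4_def by blast
  obtain K where K: "K \<subseteq> ?F" "a \<in> K" "conn (compl_graph E) K"
      "\<forall>k\<in>K. \<forall>z\<in>?F - K. \<not> compl_graph E k z"
    using component_exists[of ?F a "compl_graph E"] fin a co.symp_E by auto
  have "x \<in> ?F" using adj[OF g] x sym by blast
  moreover have "compl_graph E a x" using x sym unfolding compl_iff by blast
  ultimately have "x \<in> K" using K(2,4) by blast
  moreover have "v \<notin> K" using K irr by blast
  moreover have "K \<subseteq> V" using K by blast
  ultimately obtain h u w where h: "h \<in> V - K" "u \<in> K" "w \<in> K" "E h u" "\<not> E h w"
    using prime[of K x a] K(2) x(2) V(1) by blast
  obtain s t where st: "s \<in> K" "t \<in> K" "compl_graph E s t" "E h s" "\<not> E h t"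
    using conn_mixed_edge[OF K(3) h(2,3), of "E h"] h by blast
  have gem: "gem v y b c d" if "y \<in> K" for y
    using that K(1) g sym unfolding gem_def P4_def by blast
  have F: "s \<in> ?F" "t \<in> ?F" using st K by auto
  have "\<not> E s t" "s \<noteq> t" using st unfolding compl_iff by auto
  have "h \<notin> ?F"
  proof
    assume "h \<in> ?F"
    then have "\<not> compl_graph E t h" using K(4) st(2) h(1) by blast
    moreover have "h \<noteq> t" using h(1) st(2) by blast
    ultimately show False using st(5) sym unfolding compl_iff by blast
  qed
  have "h \<in> V" using h by blast
  have "h \<noteq> v" using st F sym by blast
  show False
  proof (cases "E v h")
    case False
    then show False
      using gem_nonneighbour_type[OF gem[OF st(1)] \<open>h \<in> V\<close>] st(4,5) \<open>h \<noteq> v\<close>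
        gem_nonneighbour_type[OF gem[OF st(2)] \<open>h \<in> V\<close>] by blast
  next
    case True
    have P: "P4 s b c d" "P4 t b c d" using gem st unfolding gem_def by auto
    have "\<not> (E h b \<and> \<not> E h c \<and> \<not> E h d)" using \<open>h \<notin> ?F\<close> True sym \<open>h \<in> V\<close> by blast
    \<comment> \<open>The traces of \<open>h\<close> on the two paths differ only at
      \<open>s\<close> and \<open>t\<close>. \<open>P4_ext\<close> admits three such patterns, one
      of which would put \<open>h\<close> into \<open>?F\<close>.\<close>
    then consider "E h b \<and> E h c \<and> E h d" | "\<not> E h b" "E h c" "\<not> E h d"
      using P4_ext[OF P(1) \<open>h \<in> V\<close>] P4_ext[OF P(2) \<open>h \<in> V\<close>] P4_ext_aux(2)[OF P(2) \<open>h \<in> V\<close>] st(4,5)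
      by argo
    then show False
    proof cases
      case 1
      then have "gem h s b c d" using P \<open>h \<in> V\<close> st(4) unfolding gem_def by blast
      then show False using adj[of h s t] F \<open>\<not> E s t\<close> st(5) sym by blast
    next
      case 2
      have "P4 s h c d" using P 2 \<open>h \<in> V\<close> st(4) sym unfolding P4_def by blast
      then have "gem v s h c d" using gem[OF st(1)] True unfolding gem_def by blast
      then show False
        using gem_no_anticentre[of v s h c d t] F \<open>\<not> E s t\<close> st(5) sym by blast
    qed
  qed
qed

text \<open>Non-adjacent \<open>r\<close> and \<open>s\<close> attached to different end edges form
  a bull with \<open>v\<close> and the middle edge; attached to the same one they are false
  clones.\<close>

lemma gem_nonneighbours_clique:
  assumes g: "gem v a b c d" and r: "r \<in> V" "\<not> E v r" "r \<noteq> v" and s: "s \<in> V" "\<not> E v s" "s \<noteq> v"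
    and "r \<noteq> s"
  shows "E r s"
proof (rule ccontr)
  assume rs: "\<not> E r s"
  have same: False
    if g: "gem v a b c d" and ab: "E r a" "E r b" "\<not> E r c" "E s a" "E s b" "\<not> E s c" for a b c d
  proof -
    \<comment> \<open>\<open>s\<close> is a false clone of the end \<open>r\<close> of the path \<open>r a v c\<close>, which has centre \<open>b\<close>.\<close>
    have "gem b r a v c"
      using g r ab sym unfolding gem_def P4_def by blast
    then show False
      using gem_no_false_clone[of b r a v c s] s ab rs \<open>r \<noteq> s\<close> sym by blast
  qed
  have mixed: False
    if g: "gem v a b c d" and "E x b" "\<not> E x c" "E y c" "\<not> E y b" "x \<in> V" "y \<in> V" "\<not> E x y"
      "\<not> E v x" "\<not> E v y" for a b c d x y
    using that no_bull[of b c v x y] unfolding gem_def P4_def by (auto simp: sym_iff)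
  have sr: "\<not> E s r" using rs sym by blast
  from gem_nonneighbour_type[OF g r] gem_nonneighbour_type[OF g s]
  show False
    using same[OF g] same[OF gem_rev[OF g]] mixed[OF g, of r s] mixed[OF g, of s r] r s rs sr
    by blast
qed

section \<open>Graphs in which no \<open>P4\<close> has a centre or an anticentre\<close>

text \<open>A vertex \<open>h\<close> mixed on the clones of \<open>a\<close> must see
  \<open>u\<close> and \<open>c\<close> but not \<open>b\<close> or \<open>d\<close>. So
  \<open>u h c d\<close> is a path, \<open>w\<close> sees \<open>u\<close> because it is no
  anticentre, and \<open>u b c h w\<close> is a house.\<close>

lemma no_gem_clone_unique:
  assumes ng: "\<nexists>v a b c d. gem v a b c d"
    and nc: "\<nexists>v a b c d. P4 a b c d \<and> v \<in> V \<and> \<not> E v a \<and> \<not> E v b \<and> \<not> E v c \<and> \<not> E v d"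
    and P: "P4 a b c d" and x: "x \<in> V" "E x b" "\<not> E x c" "\<not> E x d"
  shows "x = a"
proof (rule ccontr)
  assume "x \<noteq> a"
  let ?A = "{x\<in>V. E x b \<and> \<not> E x c \<and> \<not> E x d}"
  have "a \<in> ?A" "b \<notin> ?A" "b \<in> V" using P irr unfolding P4_def by auto
  then obtain h u w where h: "h \<in> V" "h \<notin> ?A" "u \<in> ?A" "w \<in> ?A" "E h u" "\<not> E h w"
    using prime[of ?A x a] x \<open>x \<noteq> a\<close> by blast
  have Q: "P4 u b c d" "P4 w b c d" using P h unfolding P4_def by auto
  have "\<not> (E h u \<and> E h b \<and> E h c \<and> E h d)" using ng Q h(1) unfolding gem_def by blast
  moreover have "\<not> (E h b \<and> \<not> E h c \<and> \<not> E h d)" using h by blast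
  ultimately have hbcd: "\<not> E h b" "E h c" "\<not> E h d"
    using P4_ext[OF Q(1) h(1)] P4_ext[OF Q(2) h(1)] P4_ext_aux(2)[OF Q(2) h(1)] h(5,6) by argo+
  have "P4 u h c d" using Q(1) hbcd h(1,5) sym unfolding P4_def by blast
  then have "E w u" using nc h(4,6) sym by blast
  then show False
    using no_house[of u b c h w] Q h(1,5,6) hbcd unfolding P4_def by (auto simp: sym_iff)
qed

lemma no_gem_P4_spans:
  assumes ng: "\<nexists>v a b c d. gem v a b c d"
    and nc: "\<nexists>v a b c d. P4 a b c d \<and> v \<in> V \<and> \<not> E v a \<and> \<not> E v b \<and> \<not> E v c \<and> \<not> E v d"
    and P: "P4 a b c d"
  shows "V = {a, b, c, d}"
proof -
  interpret co: prime_C5_free V "compl_graph E" by (rule complement_C5_free)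
  have coco: "compl_graph (compl_graph E) = E"
    using irr by (simp add: compl_compl)
  have P4co: "P4 b d a c" if "co.P4 a b c d" for a b c d
    using co.P4_compl[OF that] coco by simp
  have cog: "\<nexists>v a b c d. co.gem v a b c d"
  proof
    assume "\<exists>v a b c d. co.gem v a b c d"
    then obtain v a b c d where "co.gem v a b c d" by blast
    then have "P4 b d a c" "v \<in> V" "\<not> E v a" "\<not> E v b" "\<not> E v c" "\<not> E v d"
      using P4co unfolding co.gem_def by (auto simp: compl_iff)
    then show False using nc by blast
  qed
  have coc: "\<nexists>v a b c d. co.P4 a b c d \<and> v \<in> V \<and> \<not> compl_graph E v a \<and> \<not> compl_graph E v b \<and>
      \<not> compl_graph E v c \<and> \<not> compl_graph E v d"
  proof
    assume "\<exists>v a b c d. co.P4 a b c d \<and> v \<in> V \<and> \<not> compl_graph E v a \<and> \<not> compl_graph E v b \<and>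
      \<not> compl_graph E v c \<and> \<not> compl_graph E v d"
    then obtain v a b c d where v: "co.P4 a b c d" "v \<in> V" "\<not> compl_graph E v a"
      "\<not> compl_graph E v b" "\<not> compl_graph E v c" "\<not> compl_graph E v d" by blast
    then have "v \<noteq> a" "v \<noteq> b" "v \<noteq> c" "v \<noteq> d" using co.sym unfolding co.P4_def by metis+
    then have "gem v b d a c" using v P4co unfolding gem_def by (auto simp: compl_iff)
    then show False using ng by blast
  qed
  have outer: "x = a" if "P4 a b c d" "x \<in> V" "E x b" "\<not> E x c" "\<not> E x d" for a b c d x
    using no_gem_clone_unique[OF ng nc that] .
  \<comment> \<open>The inner vertices \<open>b\<close> and \<open>c\<close> are the ends of the
    complementary path \<open>b d a c\<close>, so this is uniqueness of end clones in the
    complement.\<close>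
  have inner: "x = b" if "P4 a b c d" "x \<in> V" "E x a" "E x c" "\<not> E x d" for a b c d x
  proof -
    have "x \<noteq> d" using that sym unfolding P4_def by blast
    then show ?thesis
      using co.no_gem_clone_unique[OF cog coc P4_compl[OF that(1)], of x] that by (auto simp: compl_iff)
  qed
  have "x \<in> {a, b, c, d}" if "x \<in> V" for x
  proof -
    have "\<not> (E x a \<and> E x b \<and> E x c \<and> E x d)" using ng P that unfolding gem_def by blast
    moreover have "\<not> (\<not> E x a \<and> \<not> E x b \<and> \<not> E x c \<and> \<not> E x d)" using nc P that by blast
    ultimately show ?thesis
      using P4_ext[OF P that] outer[OF P that] outer[OF P4_rev[OF P] that] inner[OF P that]
        inner[OF P4_rev[OF P] that] by blast
  qed
  then show ?thesis using P unfolding P4_def by blast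
qed

section \<open>Reduction to the triangle-free case\<close>

text \<open>By \<open>triangle_everywhere\<close> in the complement, \<open>v\<close> would have two
  non-adjacent non-neighbours.\<close>

lemma gem_no_cotriangle:
  assumes g: "gem v a b c d"
    and "x \<in> V" "y \<in> V" "z \<in> V" "compl_graph E x y" "compl_graph E y z" "compl_graph E x z"
  shows False
proof -
  interpret co: prime_graph V "compl_graph E" by (rule complement)
  have "v \<in> V" using g unfolding gem_def by blast
  then obtain r s where "r \<in> V" "s \<in> V" "compl_graph E v r" "compl_graph E v s" "compl_graph E r s"
    using co.triangle_everywhere[OF assms(2-7)] by blast
  then show False using gem_nonneighbours_clique[OF g, of r s] unfolding compl_iff by blast
qed

lemma triangle_free_or_cotriangle_free:
  "(\<nexists>x y z. x \<in> V \<and> y \<in> V \<and> z \<in> V \<and> E x y \<and> E y z \<and> E x z) \<or>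
   (\<nexists>x y z. x \<in> V \<and> y \<in> V \<and> z \<in> V \<and>
      compl_graph E x y \<and> compl_graph E y z \<and> compl_graph E x z)"
proof (cases "\<exists>v a b c d. gem v a b c d")
  case True
  then show ?thesis using gem_no_cotriangle by blast
next
  case ng: False
  interpret co: prime_C5_free V "compl_graph E" by (rule complement_C5_free)
  have coco: "compl_graph (compl_graph E) = E"
    using irr by (simp add: compl_compl)
  show ?thesis
  proof (cases "\<exists>v a b c d. P4 a b c d \<and> v \<in> V \<and> \<not> E v a \<and> \<not> E v b \<and> \<not> E v c \<and> \<not> E v d")
    case True
    then obtain v a b c d where v: "P4 a b c d" "v \<in> V" "\<not> E v a" "\<not> E v b" "\<not> E v c" "\<not> E v d"
      by blast
    then have "v \<noteq> a" "v \<noteq> b" "v \<noteq> c" "v \<noteq> d" using sym unfolding P4_def by metis+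
    then have "co.gem v b d a c" using v P4_compl unfolding co.gem_def by (auto simp: compl_iff)
    then show ?thesis using co.gem_no_cotriangle[of v b d a c] unfolding coco by blast
  next
    case False
    obtain a b c d where P: "P4 a b c d" using P4_exists by blast
    have V: "V = {a, b, c, d}" using no_gem_P4_spans[OF ng False P] .
    have "False" if "x \<in> V" "y \<in> V" "z \<in> V" "E x y" "E y z" "E x z" for x y z
    proof -
      have xyz: "x \<in> {a, b, c, d}" "y \<in> {a, b, c, d}" "z \<in> {a, b, c, d}" using that V by auto
      have "E a b" "E b c" "E c d" "\<not> E a c" "\<not> E a d" "\<not> E b d" using P unfolding P4_def by auto
      then show False using xyz that(4-6) irr by (auto simp: sym_iff)
    qed
    then show ?thesis by blast
  qed
qed

section \<open>Triangle-free graphs as half graphs\<close>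

lemma triangle_free_half_graph:
  assumes tf: "\<nexists>x y z. x \<in> V \<and> y \<in> V \<and> z \<in> V \<and> E x y \<and> E y z \<and> E x z"
  shows "is_half_graph V E"
proof -
  define N where "N y = {z\<in>V. E y z}" for y
  define deg where "deg y = card (N y)" for y
  have finN: "finite (N y)" for y using fin unfolding N_def by simp
  have "V \<noteq> {}" using three_distinct by blast
  then have "Max (deg ` V) \<in> deg ` V" using fin by simp
  then obtain x where x: "x \<in> V" and "deg x = Max (deg ` V)" by force
  then have xmax: "deg y \<le> deg x" if "y \<in> V" for y using that fin by simp
  define A where "A = N x"
  define B where "B = V - A"
  have finAB: "finite A" "finite B" using fin unfolding A_def B_def N_def by auto
  have AV: "A \<subseteq> V" and BV: "B \<subseteq> V" unfolding A_def B_def N_def by auto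
  have xA: "E x a" if "a \<in> A" for a using that unfolding A_def N_def by blast
  have xB: "x \<in> B" using x irr unfolding B_def A_def N_def by blast
  have Astable: "\<not> E a a'" if "a \<in> A" "a' \<in> A" for a a'
    using that tf x unfolding A_def N_def by blast
  \<comment> \<open>An edge inside \<open>B\<close> lies in a component \<open>K\<close> of the
    non-neighbours of \<open>x\<close>, and some \<open>z\<close> in \<open>A\<close> is mixed on an
    edge \<open>u w\<close> of \<open>K\<close>. Each \<open>a\<close> in \<open>A\<close> sees
    \<open>u\<close>, as otherwise \<open>a x z u w\<close> is a \<open>P5\<close> or a
    \<open>C5\<close>; so \<open>u\<close> has larger degree than \<open>x\<close>.\<close>
  have Bstable: "\<not> E c d" if cd: "c \<in> B" "d \<in> B" for c d
  proof
    assume "E c d"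
    let ?R = "{y\<in>V. \<not> E x y \<and> y \<noteq> x}"
    have cdR: "c \<in> ?R" "d \<in> ?R"
      using cd \<open>E c d\<close> sym unfolding B_def A_def N_def by blast+
    obtain K where K: "K \<subseteq> ?R" "c \<in> K" "conn E K" "\<forall>k\<in>K. \<forall>z\<in>?R - K. \<not> E k z"
      using component_exists[of ?R c E] fin cdR symp_E by auto
    have "d \<in> K" using K cdR \<open>E c d\<close> by blast
    have "K \<subseteq> V" "K \<noteq> {}" "K \<noteq> V" using K x by auto
    then obtain y z where yz: "y \<in> K" "z \<in> V - K" "E y z" using edge_across by blast
    have "E x z" using yz K sym by blast
    have "\<not> (E z c \<and> E z d)" using tf yz cdR \<open>E c d\<close> by blast
    then obtain u w where uw: "u \<in> K" "w \<in> K" "E u w" "E z u" "\<not> E z w"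
      using conn_mixed_edge[OF K(3) yz(1), of _ "E z"] K(2) \<open>d \<in> K\<close> sym[OF yz(3)] by metis
    have uwR: "u \<in> ?R" "w \<in> ?R" using uw K by auto
    have "E u a" if "a \<in> A" for a
    proof (rule ccontr)
      assume "\<not> E u a"
      have "z \<in> A" using yz \<open>E x z\<close> unfolding A_def N_def by simp
      then have "\<not> E a z" by (rule Astable[OF that])
      moreover have "a \<in> V" "E x a" using that AV xA by auto
      moreover have "z \<in> V" "u \<in> V" "w \<in> V" "\<not> E x u" "\<not> E x w" using yz uwR by auto
      ultimately show False
        using no_P5[of a x z u w] no_C5[of a x z u w] x \<open>E x z\<close> \<open>\<not> E u a\<close> uw(3-5)
        unfolding C5_def by (simp add: sym_iff)
    qed
    then have "insert w A \<subseteq> N u" using AV uw uwR unfolding N_def by blast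
    moreover have "w \<notin> A" using uwR unfolding A_def N_def by blast
    ultimately have "Suc (card A) \<le> card (N u)"
      using finAB card_mono[OF finN, of "insert w A" u] by simp
    then show False using xmax[of u] uwR unfolding deg_def A_def by simp
  qed
  have NA: "N a \<subseteq> B" if "a \<in> A" for a
    using that Astable unfolding N_def B_def by blast
  have NB: "N b \<subseteq> A" if "b \<in> B" for b
    using that Bstable unfolding N_def B_def by blast
  \<comment> \<open>Incomparable neighbourhoods on one side would give the induced path
    \<open>b a x a' b'\<close>.\<close>
  have cross: False if "a \<in> A" "a' \<in> A" "b \<in> B" "b' \<in> B" "E a b" "\<not> E a' b" "E a' b'" "\<not> E a b'"
    for a a' b b'
    using no_P5[of b a x a' b'] that AV BV x xA Astable Bstable xB sym by blast
  have nestA: "N a \<subseteq> N a' \<or> N a' \<subseteq> N a" if "a \<in> A" "a' \<in> A" for a a'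
  proof (rule ccontr)
    assume "\<not> ?thesis"
    then obtain b b' where "b \<in> N a" "b \<notin> N a'" "b' \<in> N a'" "b' \<notin> N a" by blast
    then show False using cross[OF that, of b b'] NA that unfolding N_def by blast
  qed
  have nestB: "N b \<subseteq> N b' \<or> N b' \<subseteq> N b" if "b \<in> B" "b' \<in> B" for b b'
  proof (rule ccontr)
    assume "\<not> ?thesis"
    then obtain a a' where a: "a \<in> N b" "a \<notin> N b'" "a' \<in> N b'" "a' \<notin> N b" by blast
    then have "a \<in> A" "a' \<in> A" using NB that by auto
    moreover have "E a b" "E a' b'" "\<not> E a' b" "\<not> E a b'"
      using a sym unfolding N_def by auto
    ultimately show False using cross[of a a' b b'] that by blast
  qed
  have twin: "y = z" if "y \<in> V" "z \<in> V" "N y = N z" for y z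
  proof (rule ccontr)
    assume "y \<noteq> z"
    moreover have "{y, z} \<subseteq> V" "{y, z} \<noteq> V" using that(1,2) not_pair[of y z] by auto
    ultimately obtain h u w where h: "h \<in> V" "u \<in> {y, z}" "w \<in> {y, z}" "E h u" "\<not> E h w"
      using prime[of "{y, z}" y z] by auto
    have "h \<in> N u" "h \<notin> N w" using h(1,4,5) unfolding N_def by (auto simp: sym_iff)
    then show False using h(2,3) that(3) by auto
  qed
  have degD: "N y \<subseteq> N z" if "N y \<subseteq> N z \<or> N z \<subseteq> N y" "deg y \<le> deg z" for y z
    using that card_seteq[OF finN, of "N z" y] unfolding deg_def by blast
  have injA: "inj_on deg A"
    by (intro inj_onI twin subset_antisym degD) (use AV nestA in auto)
  have injB: "inj_on deg B"
    by (intro inj_onI twin subset_antisym degD) (use BV nestB in auto)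
  have ne: "N y \<noteq> {}" if "y \<in> V" for y
    using edge_across[of "{y}"] that not_pair[of y y] unfolding N_def by auto
  have pos: "1 \<le> deg y" if "y \<in> V" for y
    using ne[OF that] finN[of y] unfolding deg_def by (simp add: Suc_leI card_gt_0_iff)
  have rangeA: "deg ` A \<subseteq> {1..card B}"
    using pos AV card_mono[OF finAB(2) NA] unfolding deg_def by auto
  have rangeB: "deg ` B \<subseteq> {1..card A}"
    using pos BV card_mono[OF finAB(1) NB] unfolding deg_def by auto
  define k where "k = card A"
  \<comment> \<open>Degrees are distinct on each side and lie between 1 and the size of the other
    side, so both sizes agree and every value occurs.\<close>
  have kB: "card B = k"
    using card_inj_on_le[OF injA rangeA] card_inj_on_le[OF injB rangeB] unfolding k_def by simp
  have imA: "deg ` A = {1..k}"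
    using card_seteq[OF _ rangeA] card_image[OF injA] kB unfolding k_def by simp
  have imB: "deg ` B = {1..k}"
    using card_seteq[OF _ rangeB] card_image[OF injB] kB unfolding k_def by simp
  have "1 \<le> k" using imageI[OF xB, of deg] unfolding imB by simp
  have count: "card {a\<in>A. P (deg a)} = card {i\<in>{1..k}. P i}" for P
  proof -
    have "deg ` {a\<in>A. P (deg a)} = {i\<in>{1..k}. P i}" using imA by auto
    moreover have "inj_on deg {a\<in>A. P (deg a)}" by (rule inj_on_subset[OF injA]) auto
    ultimately show ?thesis using card_image by metis
  qed
  \<comment> \<open>An edge puts all \<open>k + 1 - deg a\<close> vertices of \<open>A\<close> of
    degree at least \<open>deg a\<close> into \<open>N b\<close>; a non-edge leaves room only for
    the \<open>k - deg a\<close> vertices of larger degree.\<close>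
  have adj: "E a b \<longleftrightarrow> k + 1 \<le> deg a + deg b" if ab: "a \<in> A" "b \<in> B" for a b
  proof
    assume "E a b"
    have "{a'\<in>A. deg a \<le> deg a'} \<subseteq> N b"
    proof
      fix a' assume a': "a' \<in> {a'\<in>A. deg a \<le> deg a'}"
      then have "N a \<subseteq> N a'" using degD nestA ab by blast
      then show "a' \<in> N b" using a' \<open>E a b\<close> ab AV BV sym unfolding N_def by blast
    qed
    then have "card {a'\<in>A. deg a \<le> deg a'} \<le> deg b"
      unfolding deg_def by (rule card_mono[OF finN])
    moreover have "{i\<in>{1..k}. deg a \<le> i} = {deg a..k}" using pos[of a] ab AV by auto
    ultimately show "k + 1 \<le> deg a + deg b" unfolding count by simp
  next
    assume le: "k + 1 \<le> deg a + deg b"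
    show "E a b"
    proof (rule ccontr)
      assume nE: "\<not> E a b"
      have "N b \<subseteq> {a'\<in>A. deg a < deg a'}"
      proof
        fix a' assume a': "a' \<in> N b"
        then have "a' \<in> A" using NB ab by blast
        moreover have "\<not> N a' \<subseteq> N a" using a' nE ab BV sym unfolding N_def by blast
        ultimately show "a' \<in> {a'\<in>A. deg a < deg a'}"
          using degD[of a' a] nestA[of a' a] ab by (auto simp: not_le[symmetric])
      qed
      then have "deg b \<le> card {a'\<in>A. deg a < deg a'}"
        unfolding deg_def[of b] using finAB by (intro card_mono) auto
      moreover have "{i\<in>{1..k}. deg a < i} = {deg a<..k}" by auto
      ultimately have "deg b \<le> k - deg a" unfolding count by simp
      moreover have "deg a \<le> k" using imA ab by auto
      ultimately show False using le by simp
    qed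
  qed
  define g where "g y = (y \<in> B, deg y)" for y
  have "inj_on g V"
    using injA injB unfolding g_def B_def inj_on_def by auto
  moreover have "g ` V = half_V k"
  proof
    show "g ` V \<subseteq> half_V k"
      using imA imB unfolding g_def half_V_def B_def by auto
    show "half_V k \<subseteq> g ` V"
    proof
      fix p assume "p \<in> half_V k"
      then obtain t i where p: "p = (t, i)" "i \<in> {1..k}" unfolding half_V_def by auto
      have "\<exists>y\<in>V. (y \<in> B) = t \<and> deg y = i"
      proof (cases t)
        case True
        then show ?thesis using p(2) BV unfolding imB[symmetric] by auto
      next
        case False
        then show ?thesis using p(2) AV unfolding imA[symmetric] B_def by auto
      qed
      then show "p \<in> g ` V" using p unfolding g_def by force
    qed
  qed
  moreover have "E y z \<longleftrightarrow> half_E k (g y) (g z)" if "y \<in> V" "z \<in> V" for y z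
  proof -
    have "y \<in> A \<or> y \<in> B" "z \<in> A \<or> z \<in> B" "A \<inter> B = {}" using that unfolding B_def by auto
    then show ?thesis
      using adj[of y z] adj[of z y] Astable[of y z] Bstable[of y z] sym_iff[of y z]
      unfolding g_def half_E_def by (auto simp: add.commute)
  qed
  ultimately have "graph_iso (half_V k) (half_E k) V E"
    by (intro graph_iso_inverse[of g]) (auto simp: bij_betw_def)
  then show ?thesis using \<open>1 \<le> k\<close> unfolding is_half_graph_def by blast
qed

end

section \<open>Transfer to the concrete graphs of the statement\<close>

lemma graph_iso_5I:
  assumes "distinct [a, b, c, d, e]"
    and "\<And>i j. i < 5 \<Longrightarrow> j < 5 \<Longrightarrow> HE i j \<longleftrightarrow> E ([a, b, c, d, e] ! i) ([a, b, c, d, e] ! j)"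
  shows "graph_iso {0..<5::nat} HE {a, b, c, d, e} E"
proof -
  have "bij_betw ((!) [a, b, c, d, e]) {0..<5} {a, b, c, d, e}"
    using bij_betw_nth[OF assms(1), of "{0..<5}" "{a, b, c, d, e}"] by (simp add: atLeast0LessThan)
  then show ?thesis unfolding graph_iso_def using assms(2) by auto
qed

lemma less_5_iff: "(i::nat) < 5 \<longleftrightarrow> i = 0 \<or> i = 1 \<or> i = 2 \<or> i = 3 \<or> i = 4"
  by auto

theorem theorem4p4:
  fixes V :: "'a set" and E :: "'a \<Rightarrow> 'a \<Rightarrow> bool"
  assumes "simple_graph V E"
    and "\<not> has_induced V E P5_V P5_E"
    and "\<not> has_induced V E P5_V (compl_graph P5_E)"
    and "\<not> has_induced V E bull_V bull_E"
  shows "card V \<le> 2 \<or> graph_iso C5_V C5_E V E \<or> (\<exists>X. homogeneous_set V E X)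
         \<or> is_half_graph V E \<or> is_half_graph V (compl_graph E)"
proof (rule ccontr)
  assume neg: "\<not> ?thesis"
  \<comment> \<open>\<open>E\<close> is arbitrary outside \<open>V\<close>, whereas the locale asks
    for symmetry and irreflexivity everywhere; the restriction has both.\<close>
  define F where "F x y \<longleftrightarrow> x \<in> V \<and> y \<in> V \<and> E x y" for x y
  have finV: "finite V" and symV: "\<And>x y. x \<in> V \<Longrightarrow> y \<in> V \<Longrightarrow> E x y \<longleftrightarrow> E y x"
    and irrV: "\<And>x. x \<in> V \<Longrightarrow> \<not> E x x"
    using assms(1) unfolding simple_graph_def by auto
  have FE: "F x y \<longleftrightarrow> E x y" if "x \<in> V" "y \<in> V" for x y using that unfolding F_def by simp
  have Fsym: "F x y \<Longrightarrow> F y x" for x y using symV unfolding F_def by blast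
  have Firr: "\<not> F x x" for x using irrV unfolding F_def by blast
  have Fsym_iff: "F x y \<longleftrightarrow> F y x" for x y using Fsym by blast
  have iso: "graph_iso {0..<5} HE {a, b, c, d, e} E"
    if "{a, b, c, d, e} \<subseteq> V" "distinct [a, b, c, d, e]"
      "\<And>i j. i < 5 \<Longrightarrow> j < 5 \<Longrightarrow> HE i j \<longleftrightarrow> F ([a, b, c, d, e] ! i) ([a, b, c, d, e] ! j)"
    for a b c d e HE
  proof (rule graph_iso_5I[OF that(2)])
    fix i j :: nat assume ij: "i < 5" "j < 5"
    have "[a, b, c, d, e] ! i \<in> V" if "i < 5" for i
      using that \<open>{a, b, c, d, e} \<subseteq> V\<close> unfolding less_5_iff by auto
    then show "HE i j \<longleftrightarrow> E ([a, b, c, d, e] ! i) ([a, b, c, d, e] ! j)"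
      using that(3)[OF ij] ij FE by simp
  qed
  interpret prime_graph V F
  proof
    show "finite V" by fact
    show "F x y \<Longrightarrow> F y x" for x y by (rule Fsym)
    show "\<not> F x x" for x by (rule Firr)
    show "3 \<le> card V" using neg by simp
    show "\<exists>h\<in>V - X. \<exists>u\<in>X. \<exists>w\<in>X. F h u \<and> \<not> F h w"
      if X: "X \<subseteq> V" "x \<in> X" "y \<in> X" "x \<noteq> y" "X \<noteq> V" for X x y
    proof -
      have "finite X" using X finV finite_subset by blast
      then have "1 < card X" using X by (metis One_nat_def card_le_Suc0_iff_eq not_le)
      moreover have "card X < card V" using X finV by (simp add: psubset_card_mono psubsetI)
      ultimately obtain h where "h \<in> V - X" "mixed_on V E h X"
        using neg X unfolding homogeneous_set_def by blast
      then show ?thesis using X FE unfolding mixed_on_def by blast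
    qed
    fix a b c d e
    assume V: "a \<in> V" "b \<in> V" "c \<in> V" "d \<in> V" "e \<in> V"
    have sub: "{a, b, c, d, e} \<subseteq> V" using V by auto
    { assume F: "F a b" "F b c" "F c d" "F d e" "\<not> F a c" "\<not> F a d" "\<not> F a e" "\<not> F b d"
        "\<not> F b e" "\<not> F c e"
      have "distinct [a, b, c, d, e]" using F Firr Fsym by simp metis
      then have "graph_iso P5_V P5_E {a, b, c, d, e} E"
        unfolding P5_V_def
        by (rule iso[OF sub])
          (use F Firr in \<open>unfold less_5_iff, elim disjE, simp_all add: P5_E_def Fsym_iff\<close>)
      then show False using assms(2) sub unfolding has_induced_def by blast }
    { assume F: "F a b" "F b c" "F c d" "F d a" "F e a" "F e b" "\<not> F a c" "\<not> F b d"
        "\<not> F e c" "\<not> F e d"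
      \<comment> \<open>In this order consecutive vertices are the non-edges of the house, so the
        list runs along its complementary path.\<close>
      have sub': "{a, c, e, d, b} \<subseteq> V" using V by auto
      have "distinct [a, c, e, d, b]" using F Firr Fsym by simp metis
      then have "graph_iso P5_V (compl_graph P5_E) {a, c, e, d, b} E"
        unfolding P5_V_def
        by (rule iso[OF sub'])
          (use F Firr in \<open>unfold less_5_iff, elim disjE, simp_all add: P5_E_def compl_iff Fsym_iff\<close>)
      then show False using assms(3) sub' unfolding has_induced_def by blast }
    { assume F: "F a b" "F b c" "F a c" "F a d" "F b e" "\<not> F c d" "\<not> F c e" "\<not> F b d"
        "\<not> F a e" "\<not> F d e"
      have "distinct [a, b, c, d, e]" using F Firr Fsym by simp metis
      then have "graph_iso bull_V bull_E {a, b, c, d, e} E"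
        unfolding bull_V_def
        by (rule iso[OF sub])
          (use F Firr in \<open>unfold less_5_iff, elim disjE, simp_all add: bull_E_def bull_edges_def Fsym_iff\<close>)
      then show False using assms(4) sub unfolding has_induced_def by blast }
  qed
  have "prime_C5_free V F"
  proof
    fix a b c d e
    show "\<not> C5 a b c d e"
    proof
      assume C: "C5 a b c d e"
      have V: "V = {a, b, c, d, e}" using C5_spans[OF C] .
      then have sub: "{a, b, c, d, e} \<subseteq> V" by simp
      have F: "F a b" "F b c" "F c d" "F d e" "F e a"
          "\<not> F a c" "\<not> F a d" "\<not> F b d" "\<not> F b e" "\<not> F c e"
        using C unfolding C5_def by auto
      have "distinct [a, b, c, d, e]" using F Firr Fsym by simp metis
      then have "graph_iso C5_V C5_E {a, b, c, d, e} E"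
        unfolding C5_V_def
        by (rule iso[OF sub])
          (use F Firr in \<open>unfold less_5_iff, elim disjE, simp_all add: C5_E_def Fsym_iff\<close>)
      then show False using neg V by simp
    qed
  qed
  then interpret prime_C5_free V F .
  interpret co: prime_C5_free V "compl_graph F" by (rule complement_C5_free)
  have "is_half_graph V F \<or> is_half_graph V (compl_graph F)"
    using triangle_free_or_cotriangle_free triangle_free_half_graph co.triangle_free_half_graph
    by blast
  moreover have "is_half_graph V F \<longleftrightarrow> is_half_graph V E"
    unfolding is_half_graph_def by (intro ex_cong1 conj_cong refl graph_iso_cong FE)
  moreover have "is_half_graph V (compl_graph F) \<longleftrightarrow> is_half_graph V (compl_graph E)"
    unfolding is_half_graph_def
    by (intro ex_cong1 conj_cong refl graph_iso_cong) (simp add: compl_iff FE)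
  ultimately show False using neg by blast
qed

end
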